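(* Let $a,t\in\mathbb{R}$ with $a\neq-\frac12$, and suppose that one of the following four cases holds: (3.1) $-\frac12<a\le 4$ and $t\in[-a-1,-\frac12)$; (3.2) $-2\le a<-\frac12$ and $t\in(-\frac12,-a-1]$; (3.3) $a>4$ and $t\in[-a-1,t_1]\cup[t_2,-\frac12)$; (3.4) $a<-2$ and $t\in(-\frac12,t_1]\cup[-a-1,t_2]$. Let $c=c(t)$, with $c\ge -a^2-2a$. Then for $b\in\mathbb{R}$ the inequality $f(x,y,z)=w_4+a w_3+b w_2+c w_1\ge 0$ holds for all $x,y,z\in\mathbb{R}$ if and only if $b\ge b(t)$. Moreover, when $b=b(t)$ we have $f(t,1,1)=f(1,t,1)=f(1,1,t)=0$.
   Context: For real $x,y,z$: $w_4=x^4+y^4+z^4$, $w_3=x^3y+y^3z+z^3x+xy^3+yz^3+zx^3$, $w_2=x^2y^2+y^2z^2+z^2x^2$, $w_1=xyz(x+y+z)$. For a fixed real $a$ and real $t\ne-\frac12$, define $$c(t)=\frac{2t^4+2(a+1)t^3+(2a+4)t^2+(3a+4)t-a}{2t+1},$$ $$b(t)=\frac{t^4+(a+4)t^3+(5a+4)t^2+4(a+1)t+2a+2}{-(2t+1)}.$$ When $(a+2)(a-4)\ge 0$, define $$t_1=\frac{-a-\sqrt{(a+2)(a-4)}}{2},\qquad t_2=\frac{-a+\sqrt{(a+2)(a-4)}}{2}.$$ *)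

theory Defs
  imports Complex_Main
begin

definition w4 :: "real \<Rightarrow> real \<Rightarrow> real \<Rightarrow> real" where
  "w4 x y z = x^4 + y^4 + z^4"

definition w3 :: "real \<Rightarrow> real \<Rightarrow> real \<Rightarrow> real" where
  "w3 x y z = x^3 * y + y^3 * z + z^3 * x + x * y^3 + y * z^3 + z * x^3"

definition w2 :: "real \<Rightarrow> real \<Rightarrow> real \<Rightarrow> real" where
  "w2 x y z = x^2 * y^2 + y^2 * z^2 + z^2 * x^2"

definition w1 :: "real \<Rightarrow> real \<Rightarrow> real \<Rightarrow> real" where
  "w1 x y z = x * y * z * (x + y + z)"

definition quartic :: "real \<Rightarrow> real \<Rightarrow> real \<Rightarrow> real \<Rightarrow> real \<Rightarrow> real \<Rightarrow> real" where
  "quartic a b c x y z = w4 x y z + a * w3 x y z + b * w2 x y z + c * w1 x y z"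

(* c_param and b_param are meaningful only for t \<noteq> -1/2. *)
definition c_param :: "real \<Rightarrow> real \<Rightarrow> real" where
  "c_param a t =
    (2 * t^4 + 2 * (a + 1) * t^3 + (2 * a + 4) * t^2 + (3 * a + 4) * t - a) / (2 * t + 1)"

definition b_param :: "real \<Rightarrow> real \<Rightarrow> real" where
  "b_param a t =
    (t^4 + (a + 4) * t^3 + (5 * a + 4) * t^2 + 4 * (a + 1) * t + 2 * a + 2) / (- (2 * t + 1))"

(* t1 and t2 are meaningful only for (a + 2) * (a - 4) \<ge> 0
   (Isabelle's sqrt also takes values on negative reals). *)
definition t1 :: "real \<Rightarrow> real" where
  "t1 a = (- a - sqrt ((a + 2) * (a - 4))) / 2"

definition t2 :: "real \<Rightarrow> real" where
  "t2 a = (- a + sqrt ((a + 2) * (a - 4))) / 2"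

end

theory Submission
  imports Defs
begin

text \<open>
  For fixed \<open>p = x + y + z\<close> and \<open>q = x y + y z + z x\<close> the quartic is affine in \<open>r = x y z\<close>, and the
  range of \<open>r\<close> is an interval whose endpoints belong to triples with two equal entries. So the quartic
  is nonnegative as soon as it is nonnegative at all \<open>(u, v, v)\<close>. For \<open>b = b(t)\<close>, \<open>c = c(t)\<close> it factors
  there as \<open>(u - t v)\<^sup>2\<close> times a binary quadratic form, whose discriminant is nonpositive iff
  \<open>(t + a + 1) (2 t\<^sup>2 + 2 a t + a + 4) / (2 t + 1) \<le> 0\<close>; the four cases are exactly this condition,
  \<open>t1\<close> and \<open>t2\<close> being the roots of the second factor.
\<close>

text \<open>Substitute \<open>w4 = p^4 - 4 * p^2 * q + 2 * q^2 + 4 * p * r\<close>,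
  \<open>w3 = (p^2 - 2 * q) * q - p * r\<close>, \<open>w2 = q^2 - 2 * p * r\<close> and
  \<open>w1 = p * r\<close>.\<close>

lemma quartic_elementary_symmetric:
  fixes a b c x y z :: real
  defines "p \<equiv> x + y + z" and "q \<equiv> x * y + y * z + z * x" and "r \<equiv> x * y * z"
  shows "quartic a b c x y z =
    p^4 - 4 * p^2 * q + 2 * q^2 + a * (p^2 - 2 * q) * q + b * q^2 + (4 - a - 2 * b + c) * p * r"
  unfolding quartic_def w4_def w3_def w2_def w1_def p_def q_def r_def by algebra

lemma affine_nonneg_between:
  fixes A B r m h :: real
  assumes "A + B * (m - h) \<ge> 0" "A + B * (m + h) \<ge> 0" "\<bar>r - m\<bar> \<le> h"
  shows "A + B * r \<ge> 0"
proof (cases "B \<ge> 0")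
  case True
  have "B * (m - h) \<le> B * r"
    using assms(3) True by (intro mult_left_mono) auto
  then show ?thesis using assms(1) by simp
next
  case False
  have "B * (m + h) \<le> B * r"
    using assms(3) False by (intro mult_left_mono_neg) auto
  then show ?thesis using assms(2) by simp
qed

lemma quartic_nonneg_if_nonneg_two_equal:
  fixes a b c x y z :: real
  assumes two_equal: "\<And>u v. quartic a b c u v v \<ge> 0"
  shows "quartic a b c x y z \<ge> 0"
proof -
  define p where "p = x + y + z"
  define q where "q = x * y + y * z + z * x"
  define r where "r = x * y * z"
  define s where "s = sqrt (p^2 - 3 * q)"
  \<comment> \<open>\<open>m\<close> and \<open>h\<close> are the midpoint and half-length of the
    interval to which the discriminant of the cubic confines \<open>r\<close>.\<close>
  define m where "m = (9 * p * q - 2 * p^3) / 27"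
  define h where "h = 2 * s^3 / 27"
  define A where "A = p^4 - 4 * p^2 * q + 2 * q^2 + a * (p^2 - 2 * q) * q + b * q^2"
  define B where "B = (4 - a - 2 * b + c) * p"
  have "2 * (p^2 - 3 * q) = (x - y)^2 + (y - z)^2 + (z - x)^2"
    unfolding p_def q_def by (simp add: power2_eq_square algebra_simps)
  also have "\<dots> \<ge> 0" by simp
  finally have "p^2 - 3 * q \<ge> 0" by simp
  then have s2: "s^2 = p^2 - 3 * q" and "s \<ge> 0"
    by (simp_all add: s_def)
  then have "h \<ge> 0" by (simp add: h_def)
  have endpoint: "A + B * (m - 2 * \<sigma>^3 / 27) \<ge> 0" if \<sigma>2: "\<sigma>^2 = p^2 - 3 * q" for \<sigma>
  proof -
    \<comment> \<open>Putting \<open>u = p - 2 * v\<close> into \<open>2 * u * v + v^2 = q\<close>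
      gives \<open>3 * v^2 - 2 * p * v + q = 0\<close>, and the sign of \<open>\<sigma>\<close>
      selects the root \<open>v\<close>: \<open>s\<close> leads to the endpoint
      \<open>m - h\<close>, \<open>- s\<close> to \<open>m + h\<close>.\<close>
    define u where "u = (p - 2 * \<sigma>) / 3"
    define v where "v = (p + \<sigma>) / 3"
    have q_eq: "q = (p^2 - \<sigma>^2) / 3" using \<sigma>2 by simp
    have p: "u + v + v = p" by (simp add: u_def v_def field_simps)
    have q: "u * v + v * v + v * u = q"
      unfolding q_eq by (simp add: u_def v_def field_simps power2_eq_square)
    have r: "u * v * v = m - 2 * \<sigma>^3 / 27"
      unfolding m_def q_eq
      by (simp add: u_def v_def field_simps power2_eq_square power3_eq_cube)
    show ?thesis
      using two_equal[of u v] unfolding quartic_elementary_symmetric p q r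
      by (simp add: A_def B_def)
  qed
  \<comment> \<open>The discriminant of the cubic with roots \<open>x, y, z\<close>.\<close>
  have "0 \<le> 27 * ((x - y) * (y - z) * (z - x))^2" by simp
  also have "27 * ((x - y) * (y - z) * (z - x))^2 = 4 * (p^2 - 3 * q)^3 - (27 * (r - m))^2"
    unfolding p_def q_def r_def m_def
    by (simp add: field_simps) algebra
  also have "\<dots> = 729 * (h^2 - (r - m)^2)"
    unfolding s2[symmetric] h_def by (simp add: power2_eq_square power3_eq_cube field_simps)
  finally have "(r - m)^2 \<le> h^2" by simp
  then have "\<bar>r - m\<bar> \<le> h"
    using \<open>h \<ge> 0\<close> abs_le_square_iff[of "r - m" h] by simp
  moreover have "A + B * (m - h) \<ge> 0"
    using endpoint[of s] s2 by (simp add: h_def)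
  moreover have "A + B * (m + h) \<ge> 0"
    using endpoint[of "- s"] s2 by (simp add: h_def)
  ultimately have "A + B * r \<ge> 0"
    by (intro affine_nonneg_between[of A B m h r])
  then show ?thesis
    unfolding quartic_elementary_symmetric A_def B_def p_def q_def r_def .
qed

text \<open>The values \<open>b_param\<close> and \<open>c_param\<close> make
  \<open>u = t * v\<close> a double root. The coefficient \<open>2 * a\<close> of
  \<open>u^3 * v\<close> then forces the middle coefficient \<open>2 * (a + t)\<close> of the
  cofactor, which is written as a completed square.\<close>

lemma quartic_two_equal_factor:
  fixes a t u v :: real
  assumes "t \<noteq> - 1 / 2"
  shows "quartic a (b_param a t) (c_param a t) u v v =
    (u - t * v)^2 * ((u + (a + t) * v)^2
      + - ((t + a + 1) * (2 * t^2 + 2 * a * t + a + 4)) / (2 * t + 1) * v^2)"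
proof -
  define d where "d = 2 * t + 1"
  define S where "S = (t + a + 1) * (2 * t^2 + 2 * a * t + a + 4)"
  define L where "L = w4 u v v + a * w3 u v v"
  have d: "d \<noteq> 0" using assms by (simp add: d_def)
  have b: "b_param a t * d = - (t^4 + (a + 4) * t^3 + (5 * a + 4) * t^2 + 4 * (a + 1) * t + 2 * a + 2)"
    using d unfolding b_param_def d_def[symmetric] by simp
  have c: "c_param a t * d = 2 * t^4 + 2 * (a + 1) * t^3 + (2 * a + 4) * t^2 + (3 * a + 4) * t - a"
    using d unfolding c_param_def d_def[symmetric] by simp
  \<comment> \<open>Multiplying by \<open>d\<close> clears both denominators and leaves a polynomial
    identity.\<close>
  have "quartic a (b_param a t) (c_param a t) u v v * d
    = L * d + (b_param a t * d) * w2 u v v + (c_param a t * d) * w1 u v v"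
    by (simp add: quartic_def L_def algebra_simps)
  also have "\<dots> = (u - t * v)^2 * ((u + (a + t) * v)^2 * d - S * v^2)"
    unfolding b c unfolding d_def L_def S_def w4_def w3_def w2_def w1_def
    by (simp add: algebra_simps power2_eq_square power3_eq_cube power4_eq_xxxx)
  also have "\<dots> = (u - t * v)^2 * ((u + (a + t) * v)^2 + - S / d * v^2) * d"
    using d by (simp add: field_simps)
  finally show ?thesis
    using d unfolding S_def d_def by simp
qed

lemma parameter_sign:
  fixes a t :: real
  assumes "(- 1 / 2 < a \<and> a \<le> 4 \<and> t \<in> {- a - 1 ..< - 1 / 2})
       \<or> (- 2 \<le> a \<and> a < - 1 / 2 \<and> t \<in> {- 1 / 2 <.. - a - 1})
       \<or> (4 < a \<and> t \<in> {- a - 1 .. t1 a} \<union> {t2 a ..< - 1 / 2})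
       \<or> (a < - 2 \<and> t \<in> {- 1 / 2 <.. t1 a} \<union> {- a - 1 .. t2 a})"
  shows "t \<noteq> - 1 / 2"
    and "- ((t + a + 1) * (2 * t^2 + 2 * a * t + a + 4)) / (2 * t + 1) \<ge> 0"
proof -
  define s where "s = sqrt ((a + 2) * (a - 4))"
  have root: "t1 a = (- a - s) / 2" "t2 a = (- a + s) / 2"
    by (simp_all add: t1_def t2_def s_def)
  have middle: "2 * t^2 + 2 * a * t + a + 4 \<ge> 0" if "- 2 \<le> a" "a \<le> 4"
  proof -
    have "2 * t^2 + 2 * a * t + a + 4 = 2 * (t + a / 2)^2 + (a + 2) * (4 - a) / 2"
      by (simp add: power2_eq_square field_simps)
    then show ?thesis using that by simp
  qed
  have outer: "2 * t^2 + 2 * a * t + a + 4 = 2 * ((t - t1 a) * (t - t2 a))" "s \<ge> 0"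
    if "a < - 2 \<or> 4 < a"
  proof -
    have "(a + 2) * (a - 4) \<ge> 0" using that by (auto simp: zero_le_mult_iff)
    then have s: "s \<ge> 0" "s^2 = (a + 2) * (a - 4)" by (simp_all add: s_def)
    then show "s \<ge> 0" by simp
    have "2 * ((t - t1 a) * (t - t2 a)) = 2 * (t + a / 2)^2 - s^2 / 2"
      unfolding root by (simp add: power2_eq_square field_simps)
    then show "2 * t^2 + 2 * a * t + a + 4 = 2 * ((t - t1 a) * (t - t2 a))"
      unfolding s(2) by (simp add: power2_eq_square field_simps)
  qed
  \<comment> \<open>Away from \<open>t = - 1 / 2\<close> the quotient has the sign of this product,
    so it suffices to track the signs of the factors.\<close>
  have "t \<noteq> - 1 / 2 \<and> ((t + a + 1) * (2 * t^2 + 2 * a * t + a + 4)) * (2 * t + 1) \<le> 0"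
    using assms
  proof (elim disjE conjE)
    assume a: "- 1 / 2 < a" "a \<le> 4" and "t \<in> {- a - 1 ..< - 1 / 2}"
    then have "t + a + 1 \<ge> 0" "2 * t + 1 < 0" by auto
    then show ?thesis using middle a by (auto intro!: mult_nonneg_nonpos mult_nonneg_nonneg)
  next
    assume a: "- 2 \<le> a" "a < - 1 / 2" and "t \<in> {- 1 / 2 <.. - a - 1}"
    then have "t + a + 1 \<le> 0" "2 * t + 1 > 0" by auto
    then show ?thesis using middle a by (auto intro!: mult_nonpos_nonneg)
  next
    assume a: "4 < a" and t: "t \<in> {- a - 1 .. t1 a} \<union> {t2 a ..< - 1 / 2}"
    \<comment> \<open>Here \<open>- a - 1 < - a / 2 < - 1 / 2\<close>, and \<open>s \<ge> 0\<close>
      puts \<open>- a / 2\<close> between \<open>t1 a\<close> and \<open>t2 a\<close>; this supplies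
      the bound that each interval leaves implicit.\<close>
    have *: "t + a + 1 \<ge> 0" "2 * t + 1 < 0" using t a outer(2) by (auto simp: root)
    have "(t - t1 a) * (t - t2 a) \<ge> 0"
      using t a outer(2) by (auto simp: root zero_le_mult_iff)
    then have "2 * t^2 + 2 * a * t + a + 4 \<ge> 0" using outer(1) a by simp
    then show ?thesis using * by (auto intro!: mult_nonneg_nonpos mult_nonneg_nonneg)
  next
    assume a: "a < - 2" and t: "t \<in> {- 1 / 2 <.. t1 a} \<union> {- a - 1 .. t2 a}"
    have *: "2 * t + 1 > 0" using t a by auto
    have "(t + a + 1) * ((t - t1 a) * (t - t2 a)) \<le> 0"
    \<comment> \<open>Since \<open>t1 a \<le> - a / 2 < - a - 1\<close>, the first interval lies
      left of all three roots; on the second, \<open>t\<close> is between \<open>t1 a\<close> and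
      \<open>t2 a\<close>.\<close>
    proof (cases "t \<le> t1 a")
      case True
      then have "t + a + 1 \<le> 0" "(t - t1 a) * (t - t2 a) \<ge> 0"
        using a outer(2) by (auto simp: root zero_le_mult_iff)
      then show ?thesis by (rule mult_nonpos_nonneg)
    next
      case False
      then have "t + a + 1 \<ge> 0" "(t - t1 a) * (t - t2 a) \<le> 0"
        using t a by (auto simp: mult_le_0_iff)
      then show ?thesis by (rule mult_nonneg_nonpos)
    qed
    then have "(t + a + 1) * (2 * t^2 + 2 * a * t + a + 4) \<le> 0"
      using outer(1) a by (simp add: mult_le_0_iff)
    then show ?thesis using * by (auto intro!: mult_nonpos_nonneg)
  qed
  then show "t \<noteq> - 1 / 2"
    and "- ((t + a + 1) * (2 * t^2 + 2 * a * t + a + 4)) / (2 * t + 1) \<ge> 0"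
    using mult_le_0_iff[of "(t + a + 1) * (2 * t^2 + 2 * a * t + a + 4)" "2 * t + 1"]
    by (auto simp: divide_le_0_iff)
qed

theorem theorem3:
  fixes a t c :: real
  assumes "a \<noteq> - 1 / 2"
    and "(- 1 / 2 < a \<and> a \<le> 4 \<and> t \<in> {- a - 1 ..< - 1 / 2})
       \<or> (- 2 \<le> a \<and> a < - 1 / 2 \<and> t \<in> {- 1 / 2 <.. - a - 1})
       \<or> (4 < a \<and> t \<in> {- a - 1 .. t1 a} \<union> {t2 a ..< - 1 / 2})
       \<or> (a < - 2 \<and> t \<in> {- 1 / 2 <.. t1 a} \<union> {- a - 1 .. t2 a})"
    and "c = c_param a t"
    and "c \<ge> - (a^2) - 2 * a"
  shows "(\<forall>b. (\<forall>x y z. quartic a b c x y z \<ge> 0) \<longleftrightarrow> b \<ge> b_param a t)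
    \<and> quartic a (b_param a t) c t 1 1 = 0
    \<and> quartic a (b_param a t) c 1 t 1 = 0
    \<and> quartic a (b_param a t) c 1 1 t = 0"
proof -
  note t = parameter_sign[OF assms(2)]
  have nonneg: "quartic a (b_param a t) c x y z \<ge> 0" for x y z
  proof (rule quartic_nonneg_if_nonneg_two_equal)
    fix u v :: real
    show "quartic a (b_param a t) c u v v \<ge> 0"
      unfolding assms(3) quartic_two_equal_factor[OF t(1)]
      using t(2) by (intro mult_nonneg_nonneg add_nonneg_nonneg zero_le_power2)
  qed
  have zero: "quartic a (b_param a t) c t 1 1 = 0"
    unfolding assms(3) quartic_two_equal_factor[OF t(1)] by simp
  \<comment> \<open>With \<open>c\<close> fixed, \<open>b\<close> enters only through
    \<open>w2 \<ge> 0\<close>. So nonnegativity persists for larger \<open>b\<close>, and fails for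
    smaller \<open>b\<close> at the zero \<open>(t, 1, 1)\<close>, where
    \<open>w2 > 0\<close>.\<close>
  have in_b: "quartic a b c x y z = quartic a (b_param a t) c x y z + (b - b_param a t) * w2 x y z"
    for b x y z
    by (simp add: quartic_def algebra_simps)
  have "(\<forall>x y z. quartic a b c x y z \<ge> 0) \<longleftrightarrow> b \<ge> b_param a t" for b
  proof
    assume "\<forall>x y z. quartic a b c x y z \<ge> 0"
    then have "quartic a b c t 1 1 \<ge> 0" by blast
    then have "(b - b_param a t) * w2 t 1 1 \<ge> 0"
      unfolding in_b[of b] zero by simp
    moreover have "w2 t 1 1 > 0"
      by (simp add: w2_def add_nonneg_pos)
    ultimately show "b \<ge> b_param a t"
      by (simp add: zero_le_mult_iff)
  next
    assume "b \<ge> b_param a t"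
    moreover have "w2 x y z \<ge> 0" for x y z
      by (simp add: w2_def)
    ultimately show "\<forall>x y z. quartic a b c x y z \<ge> 0"
      unfolding in_b[of b] by (simp add: nonneg)
  qed
  moreover have "quartic a (b_param a t) c 1 t 1 = 0" "quartic a (b_param a t) c 1 1 t = 0"
    using zero by (simp_all add: quartic_def w4_def w3_def w2_def w1_def algebra_simps)
  ultimately show ?thesis using zero by blast
qed

end
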